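(* Let $A$ be a polarized complex abelian variety of dimension $g$ with the action of a group $G$, and let $\beta$ be a symplectic basis for $A$ with respect to which the polarization on $A$ has matrix $J_E=\begin{pmatrix}0&E\\-E&0\end{pmatrix}$, where $E=\mathrm{diag}(d_1,\dots,d_g)$. Assume that the rational representation of $G$ in the basis $\beta$ is given by $\rho_r:G\to \mathrm{Sp}^E(2g\times 2g,\mathbb{Z})$. Let $B=V_B/L_B$ be an abelian subvariety of $A$ of dimension $h$ to which the action of $G$ on $A$ restricts, and let $i_B:B\to A$ denote the natural inclusion. Let $\beta_B=\{u_1,\dots,u_{2h}\}$ be a symplectic basis for $B$ (that is, of $L_B$) for which the induced polarization on $B$ has the form $J_D=\begin{pmatrix}0&D\\-D&0\end{pmatrix}$ with $D=\mathrm{diag}(n_1,\dots,n_h)$. Then the rational representation of $G$ (acting on $B$) in the basis $\beta_B$ is given by $\rho_{r,B}:G\to\mathrm{Sp}^D(2h\times 2h,\mathbb{Z})$, where for every $s\in G$, $\rho_{r,B}(s)$ is the unique matrix in $\mathrm{Sp}^D(2h\times 2h,\mathbb{Z})$ satisfying $$\rho_r(s)\cdot\rho_r(i_B)=\rho_r(i_B)\cdot\rho_{r,B}(s),$$ where $\rho_r(i_B)\in M(2g\times 2h,\mathbb{Z})$ is the rational representation of $i_B$ with respect to the bases $\beta_B$ and $\beta$. Furthermore, the period matrix for $B$ with respect to the bases $\beta_B$ for $L_B$ and $\alpha_B=\{\frac1{n_1}u_1,\dots,\frac1{n_h}u_h\}$ for $V_B$ is of the form $\Pi_B=(D\;Z_B)$,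 where $Z_B\in\mathbb{H}_h$ satisfies $$Z_B\,\gamma\,D^{-1}Z_B+D\,\alpha\,D^{-1}Z_B-Z_B\,\delta-D\,\mu=0$$ for each $s\in G$, where $\rho_{r,B}(s)=\begin{pmatrix}\alpha&\mu\\\gamma&\delta\end{pmatrix}$ with $\alpha,\mu,\gamma,\delta$ integral $h\times h$ matrices (depending on $s$). Also, the analytic representation of the action of $s\in G$ restricted to $B$, with respect to the basis $\alpha_B$, is given by $$\rho_{a,B}(s)=(D\,\alpha+Z_B\,\gamma)\,D^{-1}.$$
   Context: Write $A=V/L$ with $V$ a complex vector space and $L$ a lattice. A polarization is regarded as a nondegenerate integral alternating form on $L$, of type $(d_1,\dots,d_g)$; a basis of $L$ is symplectic if the form has matrix $J_E=\begin{pmatrix}0&E\\-E&0\end{pmatrix}$, $E=\mathrm{diag}(d_1,\dots,d_g)$. Sign convention: for the alternating form $F$ with matrix $J_E$, extended $\mathbb{R}$-linearly to $V$, the form $(x,y)\mapsto F(x,iy)$ is symmetric positive definite. A subvariety $B=V_B/L_B$ carries the polarization induced by restriction. $\mathrm{Sp}^E(2g\times 2g,\mathbb{Z})=\{N\in M(2g\times 2g,\mathbb{Z}):N^tJ_EN=J_E\}$, and similarly $\mathrm{Sp}^D(2h\times 2h,\mathbb{Z})$ with $J_D$. $\mathbb{H}_h=\{Z\in M(h\times h,\mathbb{C}):Z^t=Z,\ \mathrm{Im}\,Z>0\}$ is the Siegel space. The period matrix of $A$ with respect to bases $\{v_1,\dots,v_g\}$ of $V$ and $\{\lambda_1,\dots,\lambda_{2g}\}$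 of $L$ is the $g\times 2g$ complex matrix $(\Pi_{j,i})$ with $\lambda_i=\sum_j\Pi_{j,i}v_j$; period matrices of $B$ are defined likewise. For a homomorphism $f:V/L\to V'/L'$ with chosen bases, the analytic representation $\rho_a(f)$ is the matrix of the induced linear map $V\to V'$ and the rational representation $\rho_r(f)$ is the integral matrix of the induced map $L\to L'$ (acting on column coordinate vectors). The action of $G$ is by automorphisms of $A$, and $\rho_r(s)$ is the rational representation of the automorphism $s$. The action restricts to $B$ when every $s\in G$ maps $B$ to itself; $\rho_{r,B}(s)$ and $\rho_{a,B}(s)$ are then the rational and analytic representations of the restriction $s|_B$. *)

theory Defs
  imports
    "HOL-Algebra.Group_Action"
    "HOL-Library.Set_Algebras"
    "Jordan_Normal_Form.Gauss_Jordan_Elimination"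
begin

section \<open>Bases and coordinate matrices\<close>

text \<open>Throughout, \<open>scale\<close> is the scalar multiplication of an ambient complex vector space, and
  bases are families \<open>b 0, \<dots>, b (n - 1)\<close>. The two restrictions of scalars below allow the same
  notion of basis to be used for complex bases, real bases and \<open>\<int>\<close>-bases of lattices.\<close>

definition real_scale :: "(complex \<Rightarrow> 'v \<Rightarrow> 'v) \<Rightarrow> real \<Rightarrow> 'v \<Rightarrow> 'v" where
  "real_scale scale r v = scale (complex_of_real r) v"

definition int_scale :: "(complex \<Rightarrow> 'v \<Rightarrow> 'v) \<Rightarrow> int \<Rightarrow> 'v \<Rightarrow> 'v" where
  "int_scale scale k v = scale (of_int k) v"

definition is_basis ::
  "('k::comm_ring_1 \<Rightarrow> 'v::ab_group_add \<Rightarrow> 'v) \<Rightarrow> 'v set \<Rightarrow> nat \<Rightarrow> (nat \<Rightarrow> 'v) \<Rightarrow> bool" where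
  "is_basis sc W n b \<longleftrightarrow>
     inj_on b {..<n} \<and> \<not> Modules.module.dependent sc (b ` {..<n}) \<and>
     Modules.module.span sc (b ` {..<n}) = W"

text \<open>The \<open>n \<times> m\<close> matrix whose \<open>j\<close>-th column holds the coordinates of \<open>w j\<close> in the basis \<open>b\<close>.\<close>

definition coord_mat ::
  "('k::comm_ring_1 \<Rightarrow> 'v::ab_group_add \<Rightarrow> 'v) \<Rightarrow> nat \<Rightarrow> (nat \<Rightarrow> 'v) \<Rightarrow> nat \<Rightarrow> (nat \<Rightarrow> 'v) \<Rightarrow> 'k mat"
  where
  "coord_mat sc m w n b =
     (THE M. M \<in> carrier_mat n m \<and> (\<forall>j<m. w j = (\<Sum>i<n. sc (M $$ (i, j)) (b i))))"

section \<open>Complex tori and their homomorphisms\<close>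

definition lattice_in :: "(complex \<Rightarrow> 'v::ab_group_add \<Rightarrow> 'v) \<Rightarrow> 'v set \<Rightarrow> 'v set \<Rightarrow> bool" where
  "lattice_in scale V L \<longleftrightarrow>
     (\<exists>n b. is_basis (real_scale scale) V n b \<and>
            Modules.module.span (int_scale scale) (b ` {..<n}) = L)"

definition is_torus :: "(complex \<Rightarrow> 'v::ab_group_add \<Rightarrow> 'v) \<Rightarrow> 'v set \<Rightarrow> 'v set \<Rightarrow> bool" where
  "is_torus scale V L \<longleftrightarrow> Modules.module.subspace scale V \<and> lattice_in scale V L"

text \<open>The points of \<open>V/L\<close> are the cosets \<open>v +o L = v + L\<close>.\<close>

definition torus :: "'v::ab_group_add set \<Rightarrow> 'v set \<Rightarrow> 'v set set" where
  "torus V L = (\<lambda>v. v +o L) ` V"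

text \<open>\<open>F\<close> is the linear map \<open>V \<rightarrow> V'\<close> inducing \<open>f : V/L \<rightarrow> V'/L'\<close>. Since \<open>V\<close> is a subspace of an ambient
  type, \<open>F\<close> is required to be extensional, which makes it unique.\<close>

definition induces ::
  "(complex \<Rightarrow> 'v::ab_group_add \<Rightarrow> 'v) \<Rightarrow> 'v set \<Rightarrow> 'v set \<Rightarrow> 'v set \<Rightarrow> 'v set
     \<Rightarrow> ('v \<Rightarrow> 'v) \<Rightarrow> ('v set \<Rightarrow> 'v set) \<Rightarrow> bool" where
  "induces scale V L V' L' F f \<longleftrightarrow>
     F \<in> extensional V \<and> F ` V \<subseteq> V' \<and> F ` L \<subseteq> L' \<and>
     (\<forall>x\<in>V. \<forall>y\<in>V. F (x + y) = F x + F y) \<and>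
     (\<forall>c. \<forall>x\<in>V. F (scale c x) = scale c (F x)) \<and>
     (\<forall>v\<in>V. f (v +o L) = F v +o L')"

definition torus_hom ::
  "(complex \<Rightarrow> 'v::ab_group_add \<Rightarrow> 'v) \<Rightarrow> 'v set \<Rightarrow> 'v set \<Rightarrow> 'v set \<Rightarrow> 'v set
     \<Rightarrow> ('v set \<Rightarrow> 'v set) \<Rightarrow> bool" where
  "torus_hom scale V L V' L' f \<longleftrightarrow> (\<exists>F. induces scale V L V' L' F f)"

definition induced_linear_map ::
  "(complex \<Rightarrow> 'v::ab_group_add \<Rightarrow> 'v) \<Rightarrow> 'v set \<Rightarrow> 'v set \<Rightarrow> 'v set \<Rightarrow> 'v set
     \<Rightarrow> ('v set \<Rightarrow> 'v set) \<Rightarrow> ('v \<Rightarrow> 'v)" where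
  "induced_linear_map scale V L V' L' f = (THE F. induces scale V L V' L' F f)"

definition analytic_rep ::
  "(complex \<Rightarrow> 'v::ab_group_add \<Rightarrow> 'v) \<Rightarrow> 'v set \<Rightarrow> 'v set \<Rightarrow> 'v set \<Rightarrow> 'v set
     \<Rightarrow> nat \<Rightarrow> (nat \<Rightarrow> 'v) \<Rightarrow> nat \<Rightarrow> (nat \<Rightarrow> 'v) \<Rightarrow> ('v set \<Rightarrow> 'v set) \<Rightarrow> complex mat" where
  "analytic_rep scale V L V' L' m b m' b' f =
     coord_mat scale m (\<lambda>j. induced_linear_map scale V L V' L' f (b j)) m' b'"

definition rational_rep ::
  "(complex \<Rightarrow> 'v::ab_group_add \<Rightarrow> 'v) \<Rightarrow> 'v set \<Rightarrow> 'v set \<Rightarrow> 'v set \<Rightarrow> 'v set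
     \<Rightarrow> nat \<Rightarrow> (nat \<Rightarrow> 'v) \<Rightarrow> nat \<Rightarrow> (nat \<Rightarrow> 'v) \<Rightarrow> ('v set \<Rightarrow> 'v set) \<Rightarrow> int mat" where
  "rational_rep scale V L V' L' m b m' b' f =
     coord_mat (int_scale scale) m (\<lambda>j. induced_linear_map scale V L V' L' f (b j)) m' b'"

definition period_matrix ::
  "(complex \<Rightarrow> 'v::ab_group_add \<Rightarrow> 'v) \<Rightarrow> nat \<Rightarrow> (nat \<Rightarrow> 'v) \<Rightarrow> (nat \<Rightarrow> 'v) \<Rightarrow> complex mat" where
  "period_matrix scale g lam v = coord_mat scale (2 * g) lam g v"

definition action_by_automorphisms ::
  "(complex \<Rightarrow> 'v::ab_group_add \<Rightarrow> 'v) \<Rightarrow> 'v set \<Rightarrow> 'v set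
     \<Rightarrow> 'a monoid \<Rightarrow> ('a \<Rightarrow> 'v set \<Rightarrow> 'v set) \<Rightarrow> bool" where
  "action_by_automorphisms scale V L G act \<longleftrightarrow>
     group_action G (torus V L) act \<and> (\<forall>s\<in>carrier G. torus_hom scale V L V L (act s))"

section \<open>Polarizations and symplectic bases\<close>

text \<open>The polarization is given as the real bilinear form \<open>F\<close> on \<open>V\<close> extending an integral alternating
  form on \<open>L\<close>; only its values on \<open>V\<close> matter. The last two lines are the sign convention.\<close>

definition polarization ::
  "(complex \<Rightarrow> 'v::ab_group_add \<Rightarrow> 'v) \<Rightarrow> 'v set \<Rightarrow> 'v set \<Rightarrow> ('v \<Rightarrow> 'v \<Rightarrow> real) \<Rightarrow> bool" where
  "polarization scale V L F \<longleftrightarrow>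
     (\<forall>x\<in>V. \<forall>y\<in>V. \<forall>z\<in>V. F (x + y) z = F x z + F y z \<and> F z (x + y) = F z x + F z y) \<and>
     (\<forall>r. \<forall>x\<in>V. \<forall>y\<in>V. F (real_scale scale r x) y = r * F x y \<and>
                        F x (real_scale scale r y) = r * F x y) \<and>
     (\<forall>x\<in>V. F x x = 0) \<and>
     (\<forall>x\<in>L. \<forall>y\<in>L. F x y \<in> \<int>) \<and>
     (\<forall>x\<in>L. (\<forall>y\<in>L. F x y = 0) \<longrightarrow> x = 0) \<and>
     (\<forall>x\<in>V. \<forall>y\<in>V. F x (scale \<i> y) = F y (scale \<i> x)) \<and>
     (\<forall>x\<in>V. x \<noteq> 0 \<longrightarrow> F x (scale \<i> x) > 0)"

definition J_mat :: "nat \<Rightarrow> (nat \<Rightarrow> int) \<Rightarrow> int mat" where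
  "J_mat g d = four_block_mat (0\<^sub>m g g) (mat_diag g d) (- mat_diag g d) (0\<^sub>m g g)"

definition symplectic_basis ::
  "(complex \<Rightarrow> 'v::ab_group_add \<Rightarrow> 'v) \<Rightarrow> 'v set \<Rightarrow> ('v \<Rightarrow> 'v \<Rightarrow> real) \<Rightarrow> nat \<Rightarrow> (nat \<Rightarrow> int)
     \<Rightarrow> (nat \<Rightarrow> 'v) \<Rightarrow> bool" where
  "symplectic_basis scale L F g d b \<longleftrightarrow>
     is_basis (int_scale scale) L (2 * g) b \<and> (\<forall>i<g. 0 < d i) \<and>
     (\<forall>i<2*g. \<forall>j<2*g. F (b i) (b j) = of_int (J_mat g d $$ (i, j)))"

definition Sp :: "nat \<Rightarrow> (nat \<Rightarrow> int) \<Rightarrow> int mat monoid" where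
  "Sp g d = \<lparr>carrier = {N \<in> carrier_mat (2 * g) (2 * g). N\<^sup>T * J_mat g d * N = J_mat g d},
             monoid.mult = (*), one = 1\<^sub>m (2 * g)\<rparr>"

definition Siegel_space :: "nat \<Rightarrow> complex mat set" where
  "Siegel_space h = {Z \<in> carrier_mat h h. Z\<^sup>T = Z \<and>
     (\<forall>x \<in> carrier_vec h. x \<noteq> 0\<^sub>v h \<longrightarrow> x \<bullet> (map_mat Im Z *\<^sub>v x) > 0)}"

section \<open>Abelian subvarieties\<close>

definition abelian_subvariety ::
  "(complex \<Rightarrow> 'v::ab_group_add \<Rightarrow> 'v) \<Rightarrow> 'v set \<Rightarrow> 'v set \<Rightarrow> 'v set \<Rightarrow> 'v set \<Rightarrow> bool" where
  "abelian_subvariety scale V L VB LB \<longleftrightarrow> VB \<subseteq> V \<and> LB = L \<inter> VB \<and> is_torus scale VB LB"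

text \<open>The natural inclusion \<open>V\<^sub>B/L\<^sub>B \<rightarrow> V/L\<close>: as a set, \<open>(v + L\<^sub>B) + L = v + L\<close>.\<close>

definition inclusion :: "'v::ab_group_add set \<Rightarrow> 'v set \<Rightarrow> 'v set" where
  "inclusion L c = c + L"

definition action_restricts ::
  "'v::ab_group_add set \<Rightarrow> 'v set \<Rightarrow> 'v set \<Rightarrow> 'a monoid \<Rightarrow> ('a \<Rightarrow> 'v set \<Rightarrow> 'v set) \<Rightarrow> bool" where
  "action_restricts L VB LB G act \<longleftrightarrow>
     (\<forall>s\<in>carrier G. act s ` (inclusion L ` torus VB LB) \<subseteq> inclusion L ` torus VB LB)"

text \<open>The restriction \<open>f|\<^sub>B\<close>, as a self-map of \<open>V\<^sub>B/L\<^sub>B\<close>.\<close>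

definition restriction ::
  "'v::ab_group_add set \<Rightarrow> 'v set \<Rightarrow> 'v set \<Rightarrow> ('v set \<Rightarrow> 'v set) \<Rightarrow> 'v set \<Rightarrow> 'v set" where
  "restriction L VB LB f c = the_inv_into (torus VB LB) (inclusion L) (f (inclusion L c))"

section \<open>Matrices\<close>

definition complex_mat :: "int mat \<Rightarrow> complex mat" where
  "complex_mat M = map_mat of_int M"

definition mat_inv :: "'k::field mat \<Rightarrow> 'k mat" where
  "mat_inv M = the (mat_inverse M)"

definition beside :: "'k::zero mat \<Rightarrow> 'k mat \<Rightarrow> 'k mat" where
  "beside M N = four_block_mat M N (0\<^sub>m 0 (dim_col M)) (0\<^sub>m 0 (dim_col N))"

end

theory Submission
  imports Defs "HOL-Analysis.Continuum_Not_Denumerable"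
begin

text \<open>Everything is read off in coordinates. An automorphism \<open>s\<close> of \<open>A\<close> that maps \<open>B\<close> to itself has a linear
  lift mapping \<open>V\<^sub>B\<close> into \<open>V\<^sub>B + L\<close>, hence into \<open>V\<^sub>B\<close> since \<open>L\<close> is countable. Writing the images
  \<open>s u\<^sub>j\<close> in the basis of \<open>L\<close> in two ways gives the intertwining relation, and comparing Gram matrices
  shows that the restricted representation is symplectic. With \<open>a\<^sub>i = u\<^sub>i / n\<^sub>i\<close> the form satisfies
  \<open>F(a\<^sub>i, a\<^sub>j) = 0\<close> and \<open>F(a\<^sub>i, u\<^bsub>h+j\<^esub>) = \<delta>\<^sub>i\<^sub>j\<close>; together with the positivity and symmetry of
  \<open>F(x, iy)\<close> this gives the complex independence of the \<open>a\<^sub>i\<close> and the Riemann relations for \<open>Z\<^sub>B\<close>. The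
  remaining identities are the blocks of \<open>\<rho>\<^sub>a \<Pi> = \<Pi> \<rho>\<^sub>r\<close>.\<close>

section \<open>Coordinates\<close>

text \<open>The relation that the \<open>THE\<close> in \<open>coord_mat\<close> selects from. The
  family \<open>b\<close> is arbitrary here, which allows expansions in image families such as
  \<open>T s (beta i)\<close> whose independence is never discussed.\<close>

definition has_coords ::
  "('k::comm_ring_1 \<Rightarrow> 'v::ab_group_add \<Rightarrow> 'v) \<Rightarrow> nat \<Rightarrow> (nat \<Rightarrow> 'v) \<Rightarrow> nat \<Rightarrow> (nat \<Rightarrow> 'v) \<Rightarrow> 'k mat \<Rightarrow> bool"
  where
  "has_coords sc m w n b M \<longleftrightarrow>
     M \<in> carrier_mat n m \<and> (\<forall>j<m. w j = (\<Sum>i<n. sc (M $$ (i, j)) (b i)))"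

lemma has_coords_cong:
  assumes "has_coords sc m w n b M" "\<And>j. j < m \<Longrightarrow> w j = w' j" "\<And>i. i < n \<Longrightarrow> b i = b' i"
  shows "has_coords sc m w' n b' M"
  using assms by (simp add: has_coords_def)

context Modules.module
begin

text \<open>Sums over indices rather than over the image set tolerate repetitions in
  \<open>b\<close>. The induction splits off the coefficient of the last vector.\<close>

lemma in_span_family_iff: "x \<in> span (b ` {..<n::nat}) \<longleftrightarrow> (\<exists>c. x = (\<Sum>i<n. c i *s b i))"
proof (induction n arbitrary: x)
  case 0
  then show ?case by simp
next
  case (Suc n)
  show ?case
  proof
    assume "x \<in> span (b ` {..<Suc n})"
    then obtain k where "x - k *s b n \<in> span (b ` {..<n})"
      by (auto simp: lessThan_Suc span_breakdown_eq)
    then obtain c where c: "x - k *s b n = (\<Sum>i<n. c i *s b i)"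
      using Suc.IH by blast
    define e where "e = c(n := k)"
    have "(\<Sum>i<n. e i *s b i) = (\<Sum>i<n. c i *s b i)"
      by (rule sum.cong) (auto simp: e_def)
    then have "x = (\<Sum>i<Suc n. e i *s b i)"
      using c by (simp add: algebra_simps e_def)
    then show "\<exists>c. x = (\<Sum>i<Suc n. c i *s b i)"
      by (intro exI[of _ e])
  next
    assume "\<exists>c. x = (\<Sum>i<Suc n. c i *s b i)"
    then obtain c where x: "x = (\<Sum>i<Suc n. c i *s b i)" ..
    show "x \<in> span (b ` {..<Suc n})"
      unfolding x by (rule span_sum, rule span_scale, rule span_base, rule imageI)
  qed
qed

text \<open>Independence of the indexed family already contains injectivity: if
  \<open>b i = b j\<close> for distinct indices, the coefficients 1 and -1 give a nontrivial
  relation. Given injectivity, relations on the indices and on the image set correspond by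
  reindexing.\<close>

lemma is_basis_iff:
  "is_basis scale W n b \<longleftrightarrow>
     (\<forall>c. (\<Sum>i<n. c i *s b i) = 0 \<longrightarrow> (\<forall>i<n. c i = 0)) \<and> span (b ` {..<n}) = W"
proof -
  have "inj_on b {..<n} \<and> independent (b ` {..<n}) \<longleftrightarrow>
        (\<forall>c. (\<Sum>i<n. c i *s b i) = 0 \<longrightarrow> (\<forall>i<n. c i = 0))" (is "?L \<longleftrightarrow> ?R")
  proof
    assume L: ?L
    show ?R
    proof (intro allI impI)
      fix c i
      assume c: "(\<Sum>i<n. c i *s b i) = 0" and i: "i < n"
      let ?e = "\<lambda>v. c (inv_into {..<n} b v)"
      have "(\<Sum>v\<in>b ` {..<n}. ?e v *s v) = (\<Sum>i<n. ?e (b i) *s b i)"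
        using L by (subst sum.reindex) auto
      also have "\<dots> = 0"
        using L c by simp
      finally have "?e (b i) = 0"
        using L i independentD[of "b ` {..<n}" "b ` {..<n}" ?e "b i"] by auto
      then show "c i = 0"
        using L i by simp
    qed
  next
    assume R: ?R
    have inj: "inj_on b {..<n}"
    proof (rule inj_onI, rule ccontr)
      fix i j
      assume ij: "i \<in> {..<n}" "j \<in> {..<n}" "b i = b j" "i \<noteq> j"
      let ?c = "\<lambda>k. (if k = i then 1 else 0) - (if k = j then 1 else 0)"
      have "(\<Sum>k<n. ?c k *s b k) =
            (\<Sum>k<n. if k = i then b k else 0) - (\<Sum>k<n. if k = j then b k else 0)"
        unfolding sum_subtractf[symmetric] by (rule sum.cong) (auto simp: scale_left_diff_distrib)
      also have "\<dots> = 0"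
        using ij by simp
      finally have "(\<Sum>k<n. ?c k *s b k) = 0" .
      from R[THEN spec, THEN mp, OF this, THEN spec, of i] show False
        using ij by simp
    qed
    moreover have "independent (b ` {..<n})"
    proof
      assume "dependent (b ` {..<n})"
      then obtain c v where c: "(\<Sum>v\<in>b ` {..<n}. c v *s v) = 0" and v: "v \<in> b ` {..<n}" "c v \<noteq> 0"
        unfolding dependent_finite[OF finite_imageI[OF finite_lessThan]] by blast
      have "(\<Sum>i<n. c (b i) *s b i) = 0"
        using c by (simp add: sum.reindex[OF inj])
      then have "\<forall>i<n. c (b i) = 0"
        using R[THEN spec, of "\<lambda>i. c (b i)"] by simp
      then show False
        using v by auto
    qed
    ultimately show ?L ..
  qed
  then show ?thesis
    unfolding is_basis_def by blast
qed

lemma basis_coords_unique: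
  assumes "is_basis scale W n b" "(\<Sum>i<n. c i *s b i) = (\<Sum>i<n. e i *s b i)" "i < n"
  shows "c i = e i"
proof -
  have "(\<Sum>i<n. (c i - e i) *s b i) = 0"
    using assms(2) by (simp add: scale_left_diff_distrib sum_subtractf)
  moreover have "\<forall>f. (\<Sum>i<n. f i *s b i) = 0 \<longrightarrow> (\<forall>i<n. f i = 0)"
    using assms(1) by (simp add: is_basis_iff)
  ultimately have "\<forall>i<n. c i - e i = 0"
    by fast
  then show ?thesis
    using assms(3) by simp
qed

lemma basis_in: "is_basis scale W n b \<Longrightarrow> i < n \<Longrightarrow> b i \<in> W"
  using span_base[of "b i" "b ` {..<n}"] by (simp add: is_basis_def)

lemma has_coords_unique:
  assumes "is_basis scale W n b" "has_coords scale m w n b M" "has_coords scale m w n b N"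
  shows "M = N"
proof (rule eq_matI)
  fix i j
  assume "i < dim_row N" "j < dim_col N"
  with assms(2,3) have "i < n" "j < m"
    "(\<Sum>i<n. M $$ (i, j) *s b i) = (\<Sum>i<n. N $$ (i, j) *s b i)"
    unfolding has_coords_def by auto
  then show "M $$ (i, j) = N $$ (i, j)"
    by (intro basis_coords_unique[OF assms(1), where c = "\<lambda>i. M $$ (i, j)"])
qed (use assms(2,3) in \<open>auto simp: has_coords_def\<close>)

lemma coord_mat_eqI:
  assumes "is_basis scale W n b" "has_coords scale m w n b M"
  shows "coord_mat scale m w n b = M"
  unfolding coord_mat_def has_coords_def[symmetric]
  by (rule the_equality) (use assms has_coords_unique[OF assms(1)] in simp_all)

lemma has_coords_coord_mat:
  assumes "is_basis scale W n b" "\<And>j. j < m \<Longrightarrow> w j \<in> W"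
  shows "has_coords scale m w n b (coord_mat scale m w n b)"
proof -
  have "span (b ` {..<n}) = W"
    using assms(1) by (simp add: is_basis_def)
  then have "\<forall>j\<in>{..<m}. \<exists>c. w j = (\<Sum>i<n. c i *s b i)"
    using assms(2) by (simp flip: in_span_family_iff)
  from bchoice[OF this] obtain c where "\<And>j. j < m \<Longrightarrow> w j = (\<Sum>i<n. c j i *s b i)"
    by auto
  then have "has_coords scale m w n b (Matrix.mat n m (\<lambda>(i, j). c j i))"
    by (simp add: has_coords_def)
  then show ?thesis
    using coord_mat_eqI[OF assms(1)] by simp
qed

text \<open>Substitute the expansions of \<open>b\<close> in \<open>c\<close> into those of
  \<open>w\<close> in \<open>b\<close>; the second matrix therefore stands on the left. The matrix
  identities of the theorem come from comparing two such products for one family.\<close>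

lemma has_coords_trans:
  assumes "has_coords scale m w n b M" "has_coords scale n b k c B"
  shows "has_coords scale m w k c (B * M)"
proof -
  have M: "M \<in> carrier_mat n m" and B: "B \<in> carrier_mat k n"
    using assms by (auto simp: has_coords_def)
  have "w j = (\<Sum>l<k. (B * M) $$ (l, j) *s c l)" if "j < m" for j
  proof -
    have "w j = (\<Sum>i<n. M $$ (i, j) *s (\<Sum>l<k. B $$ (l, i) *s c l))"
      using assms that by (simp add: has_coords_def)
    also have "\<dots> = (\<Sum>l<k. \<Sum>i<n. (B $$ (l, i) * M $$ (i, j)) *s c l)"
      by (subst sum.swap) (simp add: scale_sum_right mult.commute)
    also have "\<dots> = (\<Sum>l<k. (B * M) $$ (l, j) *s c l)"
      using M B that by (intro sum.cong) (auto simp: scalar_prod_def scale_sum_left lessThan_atLeast0)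
    finally show ?thesis .
  qed
  then show ?thesis
    using M B by (simp add: has_coords_def)
qed

text \<open>The target carries its own scaling \<open>sc\<close>, so that one induction serves for
  maps linear on \<open>W\<close> only and for \<open>F\<close> in either argument, where
  \<open>sc\<close> is multiplication of reals.\<close>

lemma additive_sum:
  assumes "subspace W" "\<And>x y. x \<in> W \<Longrightarrow> y \<in> W \<Longrightarrow> T (x + y) = T x + T y"
    "\<And>k x. x \<in> W \<Longrightarrow> T (k *s x) = sc k (T x)"
    "finite A" "\<And>i. i \<in> A \<Longrightarrow> b i \<in> W" "T 0 = 0"
  shows "T (\<Sum>i\<in>A. c i *s b i) = (\<Sum>i\<in>A. sc (c i) (T (b i)))"
  using assms(4,5)
proof (induction A rule: finite_induct)
  case (insert x A)
  have "(\<Sum>i\<in>A. c i *s b i) \<in> W"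
    using insert by (intro subspace_sum assms(1) subspace_scale) auto
  moreover have "c x *s b x \<in> W"
    using insert by (intro subspace_scale assms(1)) auto
  ultimately show ?case
    using insert assms(2,3) by simp
qed (simp add: assms)

lemma has_coords_image:
  assumes "has_coords scale m w n b M" "subspace W" "\<And>i. i < n \<Longrightarrow> b i \<in> W"
    "\<And>x y. x \<in> W \<Longrightarrow> y \<in> W \<Longrightarrow> T (x + y) = T x + T y"
    "\<And>k x. x \<in> W \<Longrightarrow> T (k *s x) = k *s T x"
  shows "has_coords scale m (\<lambda>j. T (w j)) n (\<lambda>i. T (b i)) M"
proof -
  have "T (\<Sum>i<n. c i *s b i) = (\<Sum>i<n. c i *s T (b i))" for c
    using assms(3) assms(4)[of 0 0] subspace_0[OF assms(2)]
    by (intro additive_sum[where W = W and sc = scale] assms(2,4,5)) auto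
  then show ?thesis
    using assms(1) by (simp add: has_coords_def)
qed

end

section \<open>Complex tori\<close>

text \<open>The real and integral restrictions of scalars become instances of the module theory, so
  that the coordinate lemmas serve complex bases, real bases and lattice bases alike.\<close>

locale complex_space = vector_space scale
  for scale :: "complex \<Rightarrow> 'v::ab_group_add \<Rightarrow> 'v" (infixr \<open>*s\<close> 75)
begin

sublocale real: vector_space "real_scale scale"
  by unfold_locales (simp_all add: real_scale_def algebra_simps)

sublocale int: Modules.module "int_scale scale"
  by unfold_locales (simp_all add: int_scale_def algebra_simps)

lemma subspace_real: "subspace W \<Longrightarrow> real.subspace W"
  by (simp add: subspace_def real.subspace_def real_scale_def)

lemma real_subspace_int: "real.subspace W \<Longrightarrow> int.subspace W"
proof -
  assume "real.subspace W"
  moreover from this have "int_scale scale c x \<in> W" if "x \<in> W" for c x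
    using real.subspace_scale[of W x "of_int c"] that by (simp add: int_scale_def real_scale_def)
  ultimately show "int.subspace W"
    by (simp add: real.subspace_def int.subspace_def)
qed

lemma has_coords_complex_mat:
  "has_coords (int_scale scale) m w n b M \<Longrightarrow> has_coords scale m w n b (complex_mat M)"
  by (auto simp: has_coords_def complex_mat_def int_scale_def intro!: sum.cong)

lemma countable_int_span: "countable (int.span (b ` {..<n::nat}))"
proof (rule countable_subset)
  \<comment> \<open>The coefficients are packed in a list because \<open>int list\<close> is a
    countable type, unlike \<open>nat \<Rightarrow> int\<close>.\<close>
  let ?f = "\<lambda>xs. \<Sum>i<n. int_scale scale (xs ! i) (b i)"
  show "countable (range ?f)"
    by (intro countable_image) simp
  show "int.span (b ` {..<n}) \<subseteq> range ?f"
  proof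
    fix x
    assume "x \<in> int.span (b ` {..<n})"
    then obtain c where "x = (\<Sum>i<n. int_scale scale (c i) (b i))"
      unfolding int.in_span_family_iff by blast
    then have "x = ?f (map c [0..<n])"
      by simp
    then show "x \<in> range ?f"
      by (rule range_eqI)
  qed
qed

lemma
  assumes "is_torus scale V L"
  shows torus_space: "subspace V"
    and lattice_subset: "L \<subseteq> V"
    and lattice_subgroup: "int.subspace L"
    and lattice_countable: "countable L"
    and lattice_real_span: "real.span L = V"
proof -
  from assms show V: "subspace V"
    by (simp add: is_torus_def)
  from assms obtain n b where "is_basis (real_scale scale) V n b" and L: "int.span (b ` {..<n}) = L"
    unfolding is_torus_def lattice_in_def by blast
  then have b: "real.span (b ` {..<n}) = V" "int.span (b ` {..<n}) = L"
    by (simp_all add: is_basis_def)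
  show "int.subspace L" "countable L"
    using b countable_int_span by auto
  show LV: "L \<subseteq> V"
    using b real.span_superset[of "b ` {..<n}"]
    by (metis int.span_minimal real_subspace_int subspace_real V)
  show "real.span L = V"
  proof
    show "real.span L \<subseteq> V"
      using LV V by (intro real.span_minimal subspace_real)
    have "b ` {..<n} \<subseteq> L"
      using int.span_superset[of "b ` {..<n}"] L by simp
    then show "V \<subseteq> real.span L"
      using b real.span_mono by blast
  qed
qed

text \<open>The real line through \<open>w\<close> is uncountable, so two of its points lie over the same element of \<open>L\<close>.\<close>

lemma line_in_countable_cosets:
  assumes U: "subspace U" and "countable L" and "\<And>r. \<exists>l\<in>L. real_scale scale r w - l \<in> U"
  shows "w \<in> U"
proof -
  obtain l where l: "\<And>r. l r \<in> L" "\<And>r. real_scale scale r w - l r \<in> U"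
    using assms(3) by metis
  have "\<not> inj l"
  proof
    assume "inj l"
    moreover have "countable (range l)"
      using l(1) by (intro countable_subset[OF _ assms(2)]) auto
    ultimately show False
      using countable_image_inj_on uncountable_UNIV_real by blast
  qed
  then obtain r r' where r: "l r = l r'" "r \<noteq> r'"
    by (auto simp: inj_def)
  have "(real_scale scale r w - l r) - (real_scale scale r' w - l r') \<in> U"
    by (intro subspace_diff U l(2))
  then have "real_scale scale (r - r') w \<in> U"
    using r(1) by (simp add: real.scale_left_diff_distrib)
  from real.subspace_scale[OF subspace_real[OF U] this]
  have "real_scale scale (1 / (r - r')) (real_scale scale (r - r') w) \<in> U" .
  moreover have "real_scale scale (1 / (r - r')) (real_scale scale (r - r') w) = w"
    using r(2) by (simp add: real_scale_def flip: of_real_mult)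
  ultimately show ?thesis
    by (simp only:)
qed

lemma coset_eq_iff: "int.subspace L \<Longrightarrow> v +o L = w +o L \<longleftrightarrow> v - w \<in> L"
proof
  assume L: "int.subspace L" and "v +o L = w +o L"
  then show "v - w \<in> L"
    using set_plus_intro2[of 0 L v] int.subspace_0[OF L] set_minus_plus by fastforce
next
  assume L: "int.subspace L" and vw: "v - w \<in> L"
  have sub: "a +o L \<subseteq> b +o L" if ab: "a - b \<in> L" for a b
  proof
    fix x
    assume "x \<in> a +o L"
    then have "x - a \<in> L"
      by (rule set_plus_imp_minus)
    from int.subspace_add[OF L this ab] show "x \<in> b +o L"
      by (intro set_minus_imp_plus) simp
  qed
  have "w - v \<in> L"
    using int.subspace_neg[OF L vw] by simp
  with sub vw show "v +o L = w +o L"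
    by blast
qed

lemma inclusion_coset:
  assumes "int.subspace L" "LB \<subseteq> L" "0 \<in> LB"
  shows "inclusion L (v +o LB) = v +o L"
proof -
  have "LB + L = L"
    using assms set_zero_plus2[of LB L] by (auto elim!: set_plus_elim intro: int.subspace_add)
  then show ?thesis
    by (simp add: inclusion_def set_plus_rearrange3)
qed

text \<open>The difference of two lifts is linear with values in \<open>L'\<close>, so the whole
  real line through such a value lies in a countable set and the value is 0. This justifies the
  \<open>THE\<close> in \<open>induced_linear_map\<close>.\<close>

lemma induces_unique:
  assumes V: "subspace V" and L': "int.subspace L'" "countable L'"
    and S: "induces scale V L V' L' S f" and T: "induces scale V L V' L' T f"
  shows "S = T"
proof (rule extensionalityI[of _ V])
  fix v
  assume v: "v \<in> V"
  have "\<exists>l\<in>L'. real_scale scale r (S v - T v) - l \<in> {0}" for r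
  proof -
    have rv: "complex_of_real r *s v \<in> V"
      by (rule subspace_scale[OF V v])
    then have "S (complex_of_real r *s v) +o L' = T (complex_of_real r *s v) +o L'"
      using S T unfolding induces_def by metis
    then have "complex_of_real r *s S v - complex_of_real r *s T v \<in> L'"
      using v S T by (simp add: coset_eq_iff[OF L'(1)] induces_def)
    then show ?thesis
      by (intro bexI) (auto simp: real_scale_def scale_right_diff_distrib)
  qed
  then have "S v - T v \<in> {0}"
    using line_in_countable_cosets[OF subspace_single_0 L'(2)] by blast
  then show "S v = T v"
    by simp
qed (use S T in \<open>auto simp: induces_def\<close>)

lemma induced_linear_map_eqI:
  assumes "is_torus scale V L" "is_torus scale V' L'" "induces scale V L V' L' T f"
  shows "induced_linear_map scale V L V' L' f = T"
  unfolding induced_linear_map_def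
  using assms induces_unique[OF torus_space lattice_subgroup lattice_countable] by blast

text \<open>\<open>compose\<close> truncates the composite to \<open>V\<close>, as the
  extensionality in \<open>induces\<close> demands. The map \<open>m\<close> is tied to
  \<open>f\<close> and \<open>k\<close> only on points of the torus, which is where the composition
  law of a group action holds.\<close>

lemma induces_compose:
  assumes "is_torus scale V L" "induces scale V L V L S f" "induces scale V L V L T k"
    and "\<And>c. c \<in> torus V L \<Longrightarrow> m c = f (k c)"
  shows "induces scale V L V L (compose V S T) m"
  using assms(2-) lattice_subset[OF assms(1)] torus_space[OF assms(1)]
  unfolding induces_def torus_def image_subset_iff
  by (auto simp: compose_def subspace_add subspace_scale subset_iff)

lemma induces_inclusion:
  assumes A: "is_torus scale V L" and B: "abelian_subvariety scale V L VB LB"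
  shows "induces scale VB LB V L (restrict id VB) (inclusion L)"
proof -
  have VB: "is_torus scale VB LB" "VB \<subseteq> V" "LB = L \<inter> VB"
    using B by (auto simp: abelian_subvariety_def)
  have "0 \<in> LB"
    using lattice_subgroup[OF VB(1)] int.subspace_0 by blast
  then show ?thesis
    using VB torus_space[OF VB(1)] inclusion_coset[OF lattice_subgroup[OF A], of LB]
    by (auto simp: induces_def subspace_add subspace_scale)
qed

text \<open>The lift of the restriction is \<open>T\<close> cut down to \<open>VB\<close>, once
  \<open>T\<close> is known to preserve \<open>VB\<close>. Invariance of the subtorus places
  \<open>T\<close> of every real multiple of \<open>v\<close> in a coset of \<open>L\<close> meeting
  \<open>VB\<close>, and \<open>line_in_countable_cosets\<close> applies with
  \<open>U = VB\<close>.\<close>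

lemma induces_restriction:
  assumes A: "is_torus scale V L" and B: "abelian_subvariety scale V L VB LB"
    and T: "induces scale V L V L T f"
    and f: "f ` (inclusion L ` torus VB LB) \<subseteq> inclusion L ` torus VB LB"
  shows "induces scale VB LB VB LB (restrict T VB) (restriction L VB LB f)"
proof -
  have VB: "is_torus scale VB LB" "VB \<subseteq> V" "LB = L \<inter> VB"
    using B by (auto simp: abelian_subvariety_def)
  note L = lattice_subgroup[OF A] and sVB = torus_space[OF VB(1)]
  have "0 \<in> LB"
    using lattice_subgroup[OF VB(1)] int.subspace_0 by blast
  then have incl: "inclusion L (v +o LB) = v +o L" for v
    using VB inclusion_coset[OF L, of LB] by blast
  \<comment> \<open>Since \<open>LB\<close> is all of \<open>L \<inter> VB\<close>, distinct points
    of B stay distinct in A; this gives meaning to the \<open>the_inv_into\<close> in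
    \<open>restriction\<close>.\<close>
  have inj: "inj_on (inclusion L) (torus VB LB)"
  proof (rule inj_onI)
    fix x y
    assume "x \<in> torus VB LB" "y \<in> torus VB LB" "inclusion L x = inclusion L y"
    then obtain v w where vw: "v \<in> VB" "w \<in> VB" "x = v +o LB" "y = w +o LB" "v +o L = w +o L"
      by (auto simp: torus_def incl)
    then have "v - w \<in> LB"
      using VB(3) subspace_diff[OF sVB] by (simp add: coset_eq_iff[OF L])
    then show "x = y"
      using vw by (simp add: coset_eq_iff[OF lattice_subgroup[OF VB(1)]])
  qed
  have Tf: "f (v +o L) = T v +o L" if "v \<in> VB" for v
    using T that VB(2) by (auto simp: induces_def)
  have T_VB: "T v \<in> VB" if v: "v \<in> VB" for v
  proof (rule line_in_countable_cosets[OF sVB lattice_countable[OF A]])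
    fix r
    have rv: "complex_of_real r *s v \<in> VB"
      by (rule subspace_scale[OF sVB v])
    then have "f (inclusion L ((complex_of_real r *s v) +o LB)) \<in> inclusion L ` torus VB LB"
      using f by (auto simp: torus_def)
    then obtain w where w: "w \<in> VB" "T (complex_of_real r *s v) +o L = w +o L"
      using Tf[OF rv] by (auto simp: incl torus_def)
    moreover have "T (complex_of_real r *s v) = complex_of_real r *s T v"
      using T v VB(2) by (auto simp: induces_def)
    ultimately have "real_scale scale r (T v) - w \<in> L"
      by (simp add: coset_eq_iff[OF L] real_scale_def)
    then show "\<exists>l\<in>L. real_scale scale r (T v) - l \<in> VB"
      using w(1) by (intro bexI[of _ "real_scale scale r (T v) - w"]) auto
  qed
  have "restriction L VB LB f (v +o LB) = T v +o LB" if v: "v \<in> VB" for v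
    unfolding restriction_def incl Tf[OF v]
    using T_VB[OF v] by (intro the_inv_into_f_eq[OF inj]) (auto simp: incl torus_def)
  moreover have "T ` LB \<subseteq> LB"
    using T T_VB VB(3) by (auto simp: induces_def)
  ultimately show ?thesis
    using T T_VB VB(2) lattice_subset[OF VB(1)] subspace_add[OF sVB] subspace_scale[OF sVB]
    unfolding induces_def image_subset_iff by (auto simp: subset_iff)
qed

end

section \<open>Riemann forms and the Siegel space\<close>

lemma J_mat_index:
  assumes "i < g" "j < g"
  shows "J_mat g d $$ (i, j) = 0"
    and "J_mat g d $$ (i, g + j) = (if i = j then d j else 0)"
    and "J_mat g d $$ (g + i, g + j) = 0"
  using assms by (auto simp: J_mat_def mat_diag_def)

lemma J_mat_carrier: "J_mat g d \<in> carrier_mat (2 * g) (2 * g)"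
  by (auto simp: J_mat_def mat_diag_def)

text \<open>The conditions of \<open>polarization\<close> that speak of the space rather than the
  lattice. They pass to every complex subspace, and are used both on \<open>V\<close> and on
  \<open>VB\<close>.\<close>

locale riemann_form = complex_space scale
  for scale :: "complex \<Rightarrow> 'v::ab_group_add \<Rightarrow> 'v" (infixr \<open>*s\<close> 75) +
  fixes W :: "'v set" and F :: "'v \<Rightarrow> 'v \<Rightarrow> real"
  assumes space: "subspace W"
    and add_left: "x \<in> W \<Longrightarrow> y \<in> W \<Longrightarrow> z \<in> W \<Longrightarrow> F (x + y) z = F x z + F y z"
    and add_right: "x \<in> W \<Longrightarrow> y \<in> W \<Longrightarrow> z \<in> W \<Longrightarrow> F z (x + y) = F z x + F z y"
    and scale_left: "x \<in> W \<Longrightarrow> y \<in> W \<Longrightarrow> F (real_scale scale r x) y = r * F x y"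
    and scale_right: "x \<in> W \<Longrightarrow> y \<in> W \<Longrightarrow> F x (real_scale scale r y) = r * F x y"
    and alternating: "x \<in> W \<Longrightarrow> F x x = 0"
    and i_symmetric: "x \<in> W \<Longrightarrow> y \<in> W \<Longrightarrow> F x (\<i> *s y) = F y (\<i> *s x)"
    and i_positive: "x \<in> W \<Longrightarrow> x \<noteq> 0 \<Longrightarrow> F x (\<i> *s x) > 0"
begin

lemma i_in: "x \<in> W \<Longrightarrow> \<i> *s x \<in> W"
  by (rule subspace_scale[OF space])

lemma zero_left: "y \<in> W \<Longrightarrow> F 0 y = 0"
  using add_left[of 0 0 y] subspace_0[OF space] by simp

lemma zero_right: "y \<in> W \<Longrightarrow> F y 0 = 0"
  using add_right[of 0 0 y] subspace_0[OF space] by simp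

lemma skew:
  assumes "x \<in> W" "y \<in> W"
  shows "F y x = - F x y"
proof -
  have "F (x + y) (x + y) = F x x + F x y + (F y x + F y y)"
    using assms subspace_add[OF space] by (simp add: add_left add_right)
  then show ?thesis
    using assms subspace_add[OF space] alternating by simp
qed

text \<open>Symmetry of \<open>F x (\<i> *s y)\<close>, applied to \<open>\<i> *s x\<close> and
  \<open>y\<close>, turns the left side into \<open>F y (- x)\<close>.\<close>

lemma i_invariant:
  assumes "x \<in> W" "y \<in> W"
  shows "F (\<i> *s x) (\<i> *s y) = F x y"
proof -
  have "F (\<i> *s x) (\<i> *s y) = F y (real_scale scale (-1) x)"
    using assms i_in i_symmetric[of "\<i> *s x" y] by (simp add: real_scale_def)
  then show ?thesis
    using assms skew[of x y] by (simp only: scale_right)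
qed

lemma sum_left:
  fixes m :: nat
  assumes "\<And>i. i < m \<Longrightarrow> b i \<in> W" "y \<in> W"
  shows "F (\<Sum>i<m. real_scale scale (c i) (b i)) y = (\<Sum>i<m. c i * F (b i) y)"
  using assms
  by (intro real.additive_sum[where W = W and T = "\<lambda>x. F x y" and sc = "(*)"])
    (auto simp: subspace_real space add_left scale_left zero_left)

lemma sum_right:
  fixes m :: nat
  assumes "\<And>i. i < m \<Longrightarrow> b i \<in> W" "y \<in> W"
  shows "F y (\<Sum>i<m. real_scale scale (c i) (b i)) = (\<Sum>i<m. c i * F y (b i))"
  using assms
  by (intro real.additive_sum[where W = W and T = "F y" and sc = "(*)"])
    (auto simp: subspace_real space add_right scale_right zero_right)

text \<open>Base change of a Gram matrix. Only the pairings of \<open>b\<close> enter, so it also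
  applies to the images of a basis under an automorphism.\<close>

lemma gram_congruence:
  assumes M: "has_coords (int_scale scale) m w k b M" and K: "K \<in> carrier_mat k k"
    and gram: "\<And>i j. i < k \<Longrightarrow> j < k \<Longrightarrow> F (b i) (b j) = of_int (K $$ (i, j))"
    and b: "\<And>i. i < k \<Longrightarrow> b i \<in> W" and w: "\<And>j. j < m \<Longrightarrow> w j \<in> W"
    and ij: "i < m" "j < m"
  shows "F (w i) (w j) = of_int ((M\<^sup>T * K * M) $$ (i, j))"
proof -
  have Mc: "M \<in> carrier_mat k m"
    using M by (simp add: has_coords_def)
  have w_eq: "w j = (\<Sum>l<k. real_scale scale (of_int (M $$ (l, j))) (b l))" if "j < m" for j
    using M that by (simp add: has_coords_def int_scale_def real_scale_def)
  have "F (w i) (w j) = (\<Sum>l<k. of_int (M $$ (l, j)) * F (w i) (b l))"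
    unfolding w_eq[OF ij(2)] by (rule sum_right[OF b w[OF ij(1)]])
  also have "\<dots> = (\<Sum>l<k. of_int (M $$ (l, j)) * (\<Sum>q<k. of_int (M $$ (q, i)) * of_int (K $$ (q, l))))"
    using b gram unfolding w_eq[OF ij(1)] by (intro sum.cong) (simp_all add: sum_left)
  also have "\<dots> = of_int ((M\<^sup>T * K * M) $$ (i, j))"
    unfolding sum_distrib_left using Mc K ij
    by (subst sum.swap)
      (simp add: scalar_prod_def lessThan_atLeast0 sum_distrib_left sum_distrib_right mult_ac)
  finally show ?thesis .
qed

end

lemma (in complex_space) polarization_riemann_form:
  assumes "polarization scale V L F" "subspace W" "W \<subseteq> V"
  shows "riemann_form scale W F"
  using assms unfolding polarization_def
  by unfold_locales (auto simp: subset_iff)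

locale symplectic_riemann_form = riemann_form +
  fixes u :: "nat \<Rightarrow> 'a" and n :: "nat \<Rightarrow> int" and h :: nat
  assumes u_in: "i < 2 * h \<Longrightarrow> u i \<in> W"
    and n_pos: "i < h \<Longrightarrow> 0 < n i"
    and gram: "i < 2 * h \<Longrightarrow> j < 2 * h \<Longrightarrow> F (u i) (u j) = of_int (J_mat h n $$ (i, j))"
begin

definition a :: "nat \<Rightarrow> 'a" where
  "a i = (1 / of_int (n i)) *s u i"

text \<open>A parametrization of the real span of \<open>a\<close>. By \<open>comb_comb\<close> this
  span is isotropic, and by \<open>comb_u\<close> pairing with \<open>u (h + j)\<close> is its j-th
  coordinate function.\<close>

definition comb :: "(nat \<Rightarrow> real) \<Rightarrow> 'a" where
  "comb c = (\<Sum>i<h. real_scale scale (c i) (a i))"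

lemma a_real: "a i = real_scale scale (1 / of_int (n i)) (u i)"
  by (simp add: a_def real_scale_def)

lemma a_in: "i < h \<Longrightarrow> a i \<in> W"
  unfolding a_def by (intro subspace_scale[OF space] u_in) simp

lemma comb_in: "comb c \<in> W"
  unfolding comb_def by (intro real.subspace_sum real.subspace_scale subspace_real space a_in) simp

lemma a_a: "i < h \<Longrightarrow> j < h \<Longrightarrow> F (a i) (a j) = 0"
  by (simp add: a_real scale_left scale_right u_in real.subspace_scale[OF subspace_real[OF space]]
      gram J_mat_index)

lemma a_u: "i < h \<Longrightarrow> j < h \<Longrightarrow> F (a i) (u (h + j)) = (if i = j then 1 else 0)"
  using n_pos[of i] n_pos[of j] by (auto simp: a_real scale_left u_in gram J_mat_index)

lemma comb_comb: "F (comb c) (comb e) = 0"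
proof -
  have "F (comb c) (a j) = 0" if "j < h" for j
    using that unfolding comb_def by (simp add: sum_left a_in a_a)
  then show ?thesis
    unfolding comb_def[of e] using comb_in by (simp add: sum_right a_in)
qed

lemma comb_u:
  assumes "j < h"
  shows "F (comb c) (u (h + j)) = c j"
proof -
  have "F (comb c) (u (h + j)) = (\<Sum>i<h. c i * F (a i) (u (h + j)))"
    unfolding comb_def using assms by (intro sum_left a_in u_in) auto
  also have "\<dots> = (\<Sum>i<h. if i = j then c i else 0)"
    using assms by (intro sum.cong) (auto simp: a_u)
  finally show ?thesis
    using assms by simp
qed

lemma complex_comb: "(\<Sum>i<h. c i *s a i) = comb (\<lambda>i. Re (c i)) + \<i> *s comb (\<lambda>i. Im (c i))"
proof -
  have "c i *s a i = real_scale scale (Re (c i)) (a i) + \<i> *s real_scale scale (Im (c i)) (a i)" for i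
    by (subst complex_eq[of "c i"]) (simp add: real_scale_def scale_left_distrib)
  then show ?thesis
    by (simp add: comb_def sum.distrib scale_sum_right)
qed

lemma comb_eq_0: "comb c = 0 \<Longrightarrow> j < h \<Longrightarrow> c j = 0"
  using comb_u[of j c] zero_left[of "u (h + j)"] u_in by simp

text \<open>The real span of \<open>a\<close> is isotropic, so it meets its multiple by \<open>\<i>\<close> only in 0.\<close>

lemma a_independent:
  assumes "(\<Sum>i<h. c i *s a i) = 0" "i < h"
  shows "c i = 0"
proof -
  define x y where "x = comb (\<lambda>i. Re (c i))" and "y = comb (\<lambda>i. Im (c i))"
  have "x + \<i> *s y = 0"
    using assms(1) by (simp add: x_def y_def complex_comb)
  then have iy: "\<i> *s y = real_scale scale (-1) x"
    by (simp add: real_scale_def add_eq_0_iff)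
  have "F y (\<i> *s y) = 0"
    unfolding iy unfolding x_def y_def by (simp only: scale_right comb_in comb_comb mult_zero_right)
  then have "y = 0"
    using i_positive[of y] by (force simp: y_def comb_in)
  moreover from this have "x = 0"
    using iy by (simp add: real_scale_def)
  ultimately show ?thesis
    using assms(2) comb_eq_0[of "\<lambda>i. Re (c i)" i] comb_eq_0[of "\<lambda>i. Im (c i)" i]
    unfolding x_def y_def by (simp add: complex_eq_iff)
qed

text \<open>Extending \<open>a\<close> to a basis of \<open>W\<close> adds nothing, because both
  families have \<open>h\<close> elements.\<close>

lemma a_basis:
  assumes span: "W \<subseteq> span (u ` {..<2 * h})" and dim: "dim W = h"
  shows "is_basis scale W h a"
proof -
  let ?S = "a ` {..<h}"
  have b: "is_basis scale (span ?S) h a"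
    using a_independent by (simp add: is_basis_iff)
  then have S: "independent ?S" "card ?S = h"
    by (auto simp: is_basis_def card_image)
  have SW: "?S \<subseteq> W"
    using a_in by auto
  then obtain B where B: "?S \<subseteq> B" "B \<subseteq> W" "independent B" "W \<subseteq> span B"
    using maximal_independent_subset_extend S(1) by blast
  \<comment> \<open>\<open>card\<close> is 0 on infinite sets, so for \<open>h = 0\<close> the
    equation \<open>card B = h\<close> does not bound \<open>B\<close>; finiteness comes from the
    finite spanning family \<open>u\<close>.\<close>
  have "finite B"
    using independent_span_bound[of "u ` {..<2 * h}" B] B span by blast
  moreover have "card B = h"
    using basis_card_eq_dim[OF B(2,4,3)] dim by simp
  ultimately have "?S = B"
    using B(1) S(2) by (intro card_subset_eq) auto
  then have "span ?S = W"
    using B(4) span_minimal[OF SW space] by auto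
  then show ?thesis
    using b by simp
qed

text \<open>Write \<open>u (h + j)\<close> as \<open>X j + \<i> *s Y j\<close> with both parts in
  the real span of \<open>a\<close>, with coordinates the real and imaginary parts of
  \<open>Z\<close>. Then \<open>Im Z\<close> is the Gram matrix of the form
  \<open>F x (\<i> *s y)\<close> on the \<open>Y j\<close>, and isotropy of the second half of
  \<open>u\<close> makes \<open>Re Z\<close> symmetric.\<close>

lemma period_in_Siegel_space:
  assumes Z: "has_coords scale h (\<lambda>j. u (h + j)) h a Z"
  shows "Z \<in> Siegel_space h"
proof -
  have Zc: "Z \<in> carrier_mat h h"
    using Z by (simp add: has_coords_def)
  define X Y where "X j = comb (\<lambda>i. Re (Z $$ (i, j)))" and "Y j = comb (\<lambda>i. Im (Z $$ (i, j)))" for j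
  have XY: "X j \<in> W" "Y j \<in> W" "\<i> *s X j \<in> W" "\<i> *s Y j \<in> W" for j
    by (auto simp: X_def Y_def comb_in i_in)
  have u: "u (h + j) = X j + \<i> *s Y j" if "j < h" for j
    using Z that by (simp add: has_coords_def complex_comb X_def Y_def)
  \<comment> \<open>In the pairing with \<open>u (h + j)\<close> the part \<open>X j\<close> drops
    out, lying in the same isotropic span.\<close>
  have comb_iY: "F (comb c) (\<i> *s Y j) = c j" if "j < h" for c j
    using that comb_u[of j c] by (simp add: u add_right comb_in XY X_def comb_comb)
  have Im_sym: "Im (Z $$ (i, j)) = Im (Z $$ (j, i))" if "i < h" "j < h" for i j
    using that comb_iY[of i "\<lambda>i. Im (Z $$ (i, j))"] comb_iY[of j "\<lambda>k. Im (Z $$ (k, i))"]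
      i_symmetric[of "Y i" "Y j"] XY by (simp flip: Y_def)
  have Re_sym: "Re (Z $$ (i, j)) = Re (Z $$ (j, i))" if "i < h" "j < h" for i j
  proof -
    \<comment> \<open>Of the four terms of the expansion the two unmixed ones vanish, the one with
      both factors \<open>\<i>\<close> by \<open>i_invariant\<close>; the mixed ones are entries of
      \<open>Re Z\<close>.\<close>
    have "0 = F (u (h + i)) (u (h + j))"
      using that by (simp add: gram J_mat_index)
    also have "\<dots> = F (X i) (X j) + F (X i) (\<i> *s Y j) + (F (\<i> *s Y i) (X j) + F (\<i> *s Y i) (\<i> *s Y j))"
      using that XY subspace_add[OF space] by (simp add: u add_left add_right)
    also have "\<dots> = F (X i) (\<i> *s Y j) - F (X j) (\<i> *s Y i)"
      using XY skew[of "X j" "\<i> *s Y i"] i_invariant[of "Y i" "Y j"]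
      by (simp add: X_def Y_def comb_comb)
    also have "\<dots> = Re (Z $$ (j, i)) - Re (Z $$ (i, j))"
      using that by (simp add: X_def comb_iY)
    finally show ?thesis
      by simp
  qed
  have "x \<bullet> (map_mat Im Z *\<^sub>v x) > 0" if x: "x \<in> carrier_vec h" "x \<noteq> 0\<^sub>v h" for x
  proof -
    \<comment> \<open>\<open>c\<close> is \<open>Im Z\<close> applied to \<open>x\<close>, so
      \<open>comb c\<close> is the combination of the \<open>Y j\<close> with coefficients
      \<open>x\<close>, and its pairing with \<open>\<i> *s comb c\<close> is the quadratic form of
      \<open>Im Z\<close> at \<open>x\<close>.\<close>
    define c where "c i = (\<Sum>j<h. Im (Z $$ (i, j)) * x $ j)" for i
    have "comb c = (\<Sum>j<h. real_scale scale (x $ j) (Y j))"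
      unfolding comb_def Y_def c_def
      by (simp add: real.scale_sum_left real.scale_sum_right mult.commute) (rule sum.swap)
    then have "\<i> *s comb c = (\<Sum>j<h. real_scale scale (x $ j) (\<i> *s Y j))"
      by (simp add: scale_sum_right real_scale_def mult.commute)
    then have pair: "F (comb e) (\<i> *s comb c) = (\<Sum>j<h. x $ j * e j)" for e
      using comb_in XY by (simp add: sum_right comb_iY)
    \<comment> \<open>For \<open>e\<close> the indicator of \<open>k\<close>, \<open>pair\<close>
      returns \<open>x $ k\<close>; hence \<open>comb c = 0\<close> would force \<open>x\<close> to
      vanish.\<close>
    have "comb c \<noteq> 0"
    proof
      assume 0: "comb c = 0"
      have "x $ k = 0" if k: "k < h" for k
      proof -
        have "x $ k = (\<Sum>j<h. if j = k then x $ j else 0)"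
          using k by simp
        also have "\<dots> = (\<Sum>j<h. x $ j * (if j = k then 1 else 0))"
          by (intro sum.cong) auto
        also have "\<dots> = 0"
          using pair[of "\<lambda>j. if j = k then 1 else 0"] by (simp only: 0 scale_zero_right zero_right comb_in)
        finally show ?thesis .
      qed
      then show False
        using x by (auto simp: vec_eq_iff)
    qed
    then have "0 < (\<Sum>j<h. x $ j * c j)"
      using i_positive[of "comb c"] comb_in by (simp add: pair)
    also have "\<dots> = x \<bullet> (map_mat Im Z *\<^sub>v x)"
      using x(1) Zc by (simp add: scalar_prod_def c_def lessThan_atLeast0)
    finally show ?thesis .
  qed
  moreover have "Z\<^sup>T = Z"
    using Zc Im_sym Re_sym by (intro eq_matI) (auto simp: complex_eq_iff)
  ultimately show ?thesis
    using Zc by (simp add: Siegel_space_def)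
qed

lemma has_coords_beside:
  assumes Z: "has_coords scale h (\<lambda>j. u (h + j)) h a Z"
  shows "has_coords scale (2 * h) u h a (beside (complex_mat (mat_diag h n)) Z)"
proof -
  let ?D = "complex_mat (mat_diag h n)"
  have Zc: "Z \<in> carrier_mat h h" and Dc: "?D \<in> carrier_mat h h"
    using Z by (auto simp: has_coords_def complex_mat_def)
  then have c: "beside ?D Z \<in> carrier_mat h (2 * h)"
    by (auto simp: beside_def)
  have "u j = (\<Sum>i<h. beside ?D Z $$ (i, j) *s a i)" if j: "j < 2 * h" for j
  proof (cases "j < h")
    case True
    have "(\<Sum>i<h. beside ?D Z $$ (i, j) *s a i) = (\<Sum>i<h. if i = j then of_int (n j) *s a j else 0)"
      using True Zc Dc by (intro sum.cong) (auto simp: beside_def complex_mat_def mat_diag_def)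
    then show ?thesis
      using True n_pos[of j] by (simp add: a_def)
  next
    case False
    then obtain k where k: "j = h + k" "k < h"
      using j by (metis add_less_cancel_left le_Suc_ex mult_2 not_less)
    have "(\<Sum>i<h. beside ?D Z $$ (i, j) *s a i) = (\<Sum>i<h. Z $$ (i, k) *s a i)"
      using k Zc Dc by (intro sum.cong) (auto simp: beside_def)
    then show ?thesis
      using k Z by (simp add: has_coords_def)
  qed
  then show ?thesis
    using c by (simp add: has_coords_def)
qed

end

section \<open>Block matrices\<close>

text \<open>\<open>mat_inv\<close> takes \<open>the\<close> of an optional value. The two-sided
  inverse \<open>B\<close> makes \<open>M\<close> a unit of the matrix ring, which excludes
  \<open>None\<close>.\<close>

lemma mat_inv:
  fixes M :: "'k::field mat"
  assumes M: "M \<in> carrier_mat n n" and B: "B \<in> carrier_mat n n" "M * B = 1\<^sub>m n" "B * M = 1\<^sub>m n"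
  shows "mat_inv M \<in> carrier_mat n n" "M * mat_inv M = 1\<^sub>m n"
proof -
  have "M \<in> Units (ring_mat TYPE('k) n ())"
    using assms by (auto simp: Units_def ring_mat_def)
  then obtain C where "mat_inverse M = Some C"
    using mat_inverse(1)[OF M, where b = "()"] by (cases "mat_inverse M") auto
  with mat_inverse(2)[OF M this] show "mat_inv M \<in> carrier_mat n n" "M * mat_inv M = 1\<^sub>m n"
    by (auto simp: mat_inv_def)
qed

lemma mat_inv_diag:
  assumes "\<And>i. i < n \<Longrightarrow> d i \<noteq> 0"
  shows "mat_inv (complex_mat (mat_diag n d)) \<in> carrier_mat n n"
    "complex_mat (mat_diag n d) * mat_inv (complex_mat (mat_diag n d)) = 1\<^sub>m n"
proof -
  have D: "complex_mat (mat_diag n d) = mat_diag n (\<lambda>i. of_int (d i))"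
    by (rule eq_matI) (auto simp: complex_mat_def mat_diag_def)
  have "mat_diag n (\<lambda>i. of_int (d i) * (1 / of_int (d i))) = (1\<^sub>m n :: complex mat)"
    by (rule eq_matI) (auto simp: mat_diag_def assms)
  then have inv: "mat_diag n (\<lambda>i. of_int (d i)) * mat_diag n (\<lambda>i. 1 / of_int (d i)) = (1\<^sub>m n :: complex mat)"
    "mat_diag n (\<lambda>i. 1 / of_int (d i)) * mat_diag n (\<lambda>i. of_int (d i)) = (1\<^sub>m n :: complex mat)"
    by (simp_all only: mat_diag_diag mult.commute)
  show "mat_inv (complex_mat (mat_diag n d)) \<in> carrier_mat n n"
    "complex_mat (mat_diag n d) * mat_inv (complex_mat (mat_diag n d)) = 1\<^sub>m n"
    unfolding D by (rule mat_inv[OF mat_diag_dim mat_diag_dim inv])+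
qed

lemma mult_beside:
  assumes "A \<in> carrier_mat k m" "M \<in> carrier_mat m p" "N \<in> carrier_mat m q"
  shows "A * beside M N = beside (A * M) (A * N)"
proof (rule eq_matI)
  fix i j
  assume "i < dim_row (beside (A * M) (A * N))" "j < dim_col (beside (A * M) (A * N))"
  then have ij: "i < k" "j < p + q"
    using assms by (auto simp: beside_def)
  then show "(A * beside M N) $$ (i, j) = beside (A * M) (A * N) $$ (i, j)"
    using assms by (auto simp: beside_def scalar_prod_def intro!: sum.cong)
qed (use assms in \<open>auto simp: beside_def\<close>)

text \<open>\<open>beside\<close> is a block matrix whose lower blocks have no rows, so the product
  rule for four blocks applies with an empty lower half.\<close>

lemma beside_mult:
  assumes "M \<in> carrier_mat k p" "N \<in> carrier_mat k q"
    "A \<in> carrier_mat p r" "B \<in> carrier_mat p s" "C \<in> carrier_mat q r" "D \<in> carrier_mat q s"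
  shows "beside M N * four_block_mat A B C D = beside (M * A + N * C) (M * B + N * D)"
proof -
  have "beside M N * four_block_mat A B C D =
        four_block_mat (M * A + N * C) (M * B + N * D)
          (0\<^sub>m 0 p * A + 0\<^sub>m 0 q * C) (0\<^sub>m 0 p * B + 0\<^sub>m 0 q * D)"
    unfolding beside_def using assms by (subst mult_four_block_mat[of _ k p _ q _ 0]) auto
  also have "\<dots> = beside (M * A + N * C) (M * B + N * D)"
    unfolding beside_def using assms by (intro cong_four_block_mat eq_matI) auto
  finally show ?thesis .
qed

lemma beside_inject:
  assumes "M \<in> carrier_mat k p" "M' \<in> carrier_mat k p" "N \<in> carrier_mat k q" "N' \<in> carrier_mat k q"
    and eq: "beside M N = beside M' N'"
  shows "M = M'" "N = N'"
proof -
  have ij: "beside M N $$ (i, j) = beside M' N' $$ (i, j)" for i j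
    using eq by simp
  have "M $$ (i, j) = M' $$ (i, j)" if "i < k" "j < p" for i j
    using ij[of i j] assms(1-4) that by (simp add: beside_def)
  then show "M = M'"
    using assms(1-4) by (intro eq_matI) auto
  have "N $$ (i, j) = N' $$ (i, j)" if "i < k" "j < q" for i j
    using ij[of i "p + j"] assms(1-4) that by (simp add: beside_def)
  then show "N = N'"
    using assms(1-4) by (intro eq_matI) auto
qed

text \<open>Comparing blocks in \<open>A (D Z) = (D Z) N\<close> gives \<open>A D = D \<alpha> + Z \<gamma>\<close> and \<open>A Z = D \<mu> + Z \<delta>\<close>; the
  quadratic equation is the second identity with \<open>A\<close> eliminated by the first.\<close>

lemma period_relation:
  fixes D Z A Di :: "complex mat"
  assumes D: "D \<in> carrier_mat h h" and Z: "Z \<in> carrier_mat h h" and A: "A \<in> carrier_mat h h"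
    and Di: "Di \<in> carrier_mat h h" "D * Di = 1\<^sub>m h"
    and blocks: "\<alpha> \<in> carrier_mat h h" "\<mu> \<in> carrier_mat h h" "\<gamma> \<in> carrier_mat h h" "\<delta> \<in> carrier_mat h h"
    and rel: "A * beside D Z = beside D Z * complex_mat (four_block_mat \<alpha> \<mu> \<gamma> \<delta>)"
  shows "A = (D * complex_mat \<alpha> + Z * complex_mat \<gamma>) * Di"
    and "Z * complex_mat \<gamma> * Di * Z + D * complex_mat \<alpha> * Di * Z
           - Z * complex_mat \<delta> - D * complex_mat \<mu> = 0\<^sub>m h h"
proof -
  define a m c d where "a = complex_mat \<alpha>" "m = complex_mat \<mu>" "c = complex_mat \<gamma>" "d = complex_mat \<delta>"
  note defs = this
  have carrier: "a \<in> carrier_mat h h" "m \<in> carrier_mat h h" "c \<in> carrier_mat h h" "d \<in> carrier_mat h h"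
    using blocks by (auto simp: defs complex_mat_def)
  have "complex_mat (four_block_mat \<alpha> \<mu> \<gamma> \<delta>) = four_block_mat a m c d"
    using blocks unfolding defs complex_mat_def by (rule map_four_block_mat)
  then have "beside (A * D) (A * Z) = beside (D * a + Z * c) (D * m + Z * d)"
    using rel by (simp add: mult_beside[OF A D Z] beside_mult[OF D Z carrier])
  from beside_inject[OF _ _ _ _ this, of h h h]
  have AD: "A * D = D * a + Z * c" and AZ: "A * Z = D * m + Z * d"
    using A D Z carrier by auto
  have "A = A * D * Di"
    using A D Di by (simp add: assoc_mult_mat[of _ h h _ h _ h])
  then show A_eq: "A = (D * complex_mat \<alpha> + Z * complex_mat \<gamma>) * Di"
    by (simp add: AD defs)
  have "A = D * a * Di + Z * c * Di"
    using A_eq D Z Di carrier by (simp add: defs add_mult_distrib_mat[of _ h h _ _ h])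
  then have "A * Z = D * a * Di * Z + Z * c * Di * Z"
    using D Z Di carrier by (simp add: add_mult_distrib_mat[of _ h h _ _ h])
  also have "\<dots> = Z * c * Di * Z + D * a * Di * Z"
    by (rule comm_add_mat[of _ h h]) (use D Z Di carrier in auto)
  finally have sum: "Z * c * Di * Z + D * a * Di * Z = D * m + Z * d"
    using AZ by simp
  show "Z * complex_mat \<gamma> * Di * Z + D * complex_mat \<alpha> * Di * Z
           - Z * complex_mat \<delta> - D * complex_mat \<mu> = 0\<^sub>m h h"
    unfolding defs[symmetric] sum using D Z carrier by (intro eq_matI) auto
qed

section \<open>The restricted action\<close>

theorem theorem3p1:
  fixes scale :: "complex \<Rightarrow> 'v::ab_group_add \<Rightarrow> 'v"
    and V L VB LB :: "'v set"
    and F :: "'v \<Rightarrow> 'v \<Rightarrow> real"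
    and G :: "'a monoid"
    and act :: "'a \<Rightarrow> 'v set \<Rightarrow> 'v set"
    and g h :: nat
    and d n :: "nat \<Rightarrow> int"
    and beta u alphaB :: "nat \<Rightarrow> 'v"
    and rho_r rho_rB :: "'a \<Rightarrow> int mat"
    and rho_aB :: "'a \<Rightarrow> complex mat"
    and P :: "int mat"
    and D PiB :: "complex mat"
  assumes "vector_space scale"
    and "is_torus scale V L"
    and "vector_space.dim scale V = g"
    and "polarization scale V L F"
    and "action_by_automorphisms scale V L G act"
    and "symplectic_basis scale L F g d beta"
    and "rho_r = (\<lambda>s. rational_rep scale V L V L (2*g) beta (2*g) beta (act s))"
    and "\<forall>s\<in>carrier G. rho_r s \<in> carrier (Sp g d)"
    and "abelian_subvariety scale V L VB LB"
    and "vector_space.dim scale VB = h"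
    and "action_restricts L VB LB G act"
    and "symplectic_basis scale LB F h n u"
    and "P = rational_rep scale VB LB V L (2*h) u (2*g) beta (inclusion L)"
    and "rho_rB =
           (\<lambda>s. rational_rep scale VB LB VB LB (2*h) u (2*h) u (restriction L VB LB (act s)))"
    and "alphaB = (\<lambda>i. scale (1 / of_int (n i)) (u i))"
    and "rho_aB =
           (\<lambda>s. analytic_rep scale VB LB VB LB h alphaB h alphaB (restriction L VB LB (act s)))"
    and "PiB = period_matrix scale h u alphaB"
    and "D = complex_mat (mat_diag h n)"
  shows "(rho_rB \<in> hom G (Sp h n) \<and>
          (\<forall>s\<in>carrier G.
             rho_r s * P = P * rho_rB s \<and>
             (\<forall>N\<in>carrier (Sp h n). rho_r s * P = P * N \<longrightarrow> N = rho_rB s))) \<and>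
         is_basis scale VB h alphaB \<and>
         (\<exists>Z\<in>Siegel_space h.
            PiB = beside D Z \<and>
            (\<forall>s\<in>carrier G. \<exists>\<alpha> \<mu> \<gamma> \<delta>.
               {\<alpha>, \<mu>, \<gamma>, \<delta>} \<subseteq> carrier_mat h h \<and>
               rho_rB s = four_block_mat \<alpha> \<mu> \<gamma> \<delta> \<and>
               Z * complex_mat \<gamma> * mat_inv D * Z + D * complex_mat \<alpha> * mat_inv D * Z
                 - Z * complex_mat \<delta> - D * complex_mat \<mu> = 0\<^sub>m h h \<and>
               rho_aB s = (D * complex_mat \<alpha> + Z * complex_mat \<gamma>) * mat_inv D))"
proof -

  \<comment> \<open>The two tori and their symplectic bases\<close>
  interpret complex_space scale
    using assms(1) by (rule complex_space.intro)
  note A = assms(2) and sub = assms(9)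
  have B: "is_torus scale VB LB" "VB \<subseteq> V" "LB = L \<inter> VB"
    using sub by (auto simp: abelian_subvariety_def)
  note sV = torus_space[OF A] and sVB = torus_space[OF B(1)]
  note LV = lattice_subset[OF A]
  interpret A: riemann_form scale V F
    by (rule polarization_riemann_form[OF assms(4) sV subset_refl])
  interpret rB: riemann_form scale VB F
    by (rule polarization_riemann_form[OF assms(4) sVB B(2)])
  have beta: "is_basis (int_scale scale) L (2 * g) beta"
    and gram_beta: "\<And>i j. i < 2 * g \<Longrightarrow> j < 2 * g \<Longrightarrow> F (beta i) (beta j) = of_int (J_mat g d $$ (i, j))"
    using assms(6) by (auto simp: symplectic_basis_def)
  have u: "is_basis (int_scale scale) LB (2 * h) u" and n_pos: "\<And>i. i < h \<Longrightarrow> 0 < n i"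
    and gram_u: "\<And>i j. i < 2 * h \<Longrightarrow> j < 2 * h \<Longrightarrow> F (u i) (u j) = of_int (J_mat h n $$ (i, j))"
    using assms(12) by (auto simp: symplectic_basis_def)
  have beta_in: "beta i \<in> L" "beta i \<in> V" if "i < 2 * g" for i
    using int.basis_in[OF beta that] LV by auto
  have u_in: "u i \<in> LB" "u i \<in> VB" "u i \<in> V" if "i < 2 * h" for i
    using int.basis_in[OF u that] B by auto
  interpret B: symplectic_riemann_form scale VB F u n h
    by unfold_locales (use u_in n_pos gram_u in auto)
  have alphaB: "alphaB = B.a"
    by (simp add: assms(15) B.a_def fun_eq_iff)

  \<comment> \<open>The complex basis of \<open>VB\<close>\<close>
  have "VB \<subseteq> span (u ` {..<2 * h})"
  proof -
    \<comment> \<open>A complex span is closed under integral and real combinations: it contains the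
      integral span \<open>LB\<close> of \<open>u\<close>, hence the real span of \<open>LB\<close>,
      which is \<open>VB\<close>.\<close>
    have "int.subspace (span (u ` {..<2 * h}))"
      by (intro real_subspace_int subspace_real subspace_span)
    then have "LB \<subseteq> span (u ` {..<2 * h})"
      using int.span_minimal[OF span_superset] u unfolding is_basis_def by blast
    then have "real.span LB \<subseteq> span (u ` {..<2 * h})"
      by (intro real.span_minimal subspace_real subspace_span)
    then show ?thesis
      by (simp add: lattice_real_span[OF B(1)])
  qed
  then have basis: "is_basis scale VB h alphaB"
    unfolding alphaB by (rule B.a_basis) (rule assms(10))

  \<comment> \<open>Linear lifts of the action\<close>
  define T where "T s = induced_linear_map scale V L V L (act s)" for s
  have T: "induces scale V L V L (T s) (act s)" if s: "s \<in> carrier G" for s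
    using s assms(5) induced_linear_map_eqI[OF A A]
    by (auto simp: T_def action_by_automorphisms_def torus_hom_def)
  have TB: "induces scale VB LB VB LB (restrict (T s) VB) (restriction L VB LB (act s))"
    if s: "s \<in> carrier G" for s
    using s assms(11) by (intro induces_restriction[OF A sub T]) (auto simp: action_restricts_def)
  have T_add: "T s (x + y) = T s x + T s y" if "s \<in> carrier G" "x \<in> V" "y \<in> V" for s x y
    using T[OF that(1)] that by (simp add: induces_def)
  have T_scale: "T s (scale c x) = scale c (T s x)" and T_V: "T s x \<in> V"
    if "s \<in> carrier G" "x \<in> V" for s x c
    using T[OF that(1)] that by (auto simp: induces_def)
  have T_L: "T s x \<in> L" if "s \<in> carrier G" "x \<in> L" for s x
    using T[OF that(1)] that by (auto simp: induces_def)
  have T_VB: "T s x \<in> VB" if "s \<in> carrier G" "x \<in> VB" for s x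
    using TB[OF that(1)] that by (auto simp: induces_def)
  have T_LB: "T s x \<in> LB" if "s \<in> carrier G" "x \<in> LB" for s x
    using that T_VB T_L B(3) by auto

  \<comment> \<open>The representations as coordinate matrices\<close>
  have rho_r: "has_coords (int_scale scale) (2 * g) (\<lambda>j. T s (beta j)) (2 * g) beta (rho_r s)"
    if s: "s \<in> carrier G" for s
    unfolding assms(7) rational_rep_def T_def[symmetric]
    by (rule int.has_coords_coord_mat[OF beta]) (simp add: T_L s beta_in)
  have P: "has_coords (int_scale scale) (2 * h) u (2 * g) beta P"
  proof -
    have "P = coord_mat (int_scale scale) (2 * h) (\<lambda>j. restrict id VB (u j)) (2 * g) beta"
      using induced_linear_map_eqI[OF B(1) A induces_inclusion[OF A sub]]
      by (simp add: assms(13) rational_rep_def)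
    moreover have "has_coords (int_scale scale) (2 * h) (\<lambda>j. restrict id VB (u j)) (2 * g) beta
      (coord_mat (int_scale scale) (2 * h) (\<lambda>j. restrict id VB (u j)) (2 * g) beta)"
      by (rule int.has_coords_coord_mat[OF beta]) (use u_in B(3) in auto)
    ultimately show ?thesis
      using u_in by (auto intro: has_coords_cong)
  qed
  have ind_B: "induced_linear_map scale VB LB VB LB (restriction L VB LB (act s)) = restrict (T s) VB"
    if s: "s \<in> carrier G" for s
    by (rule induced_linear_map_eqI[OF B(1) B(1) TB[OF s]])
  have rho_rB: "has_coords (int_scale scale) (2 * h) (\<lambda>j. T s (u j)) (2 * h) u (rho_rB s)"
    if s: "s \<in> carrier G" for s
  proof (rule has_coords_cong)
    show "has_coords (int_scale scale) (2 * h) (\<lambda>j. restrict (T s) VB (u j)) (2 * h) u (rho_rB s)"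
      unfolding assms(14) rational_rep_def ind_B[OF s]
      by (rule int.has_coords_coord_mat[OF u]) (use u_in T_LB s in auto)
  qed (use u_in in auto)
  have rho_aB: "has_coords scale h (\<lambda>j. T s (alphaB j)) h alphaB (rho_aB s)"
    if s: "s \<in> carrier G" for s
  proof (rule has_coords_cong)
    show "has_coords scale h (\<lambda>j. restrict (T s) VB (alphaB j)) h alphaB (rho_aB s)"
      unfolding assms(16) analytic_rep_def ind_B[OF s]
      by (rule has_coords_coord_mat[OF basis]) (use B.a_in T_VB s in \<open>auto simp: alphaB\<close>)
  qed (use B.a_in in \<open>auto simp: alphaB\<close>)
  have T_image: "has_coords (int_scale scale) m (\<lambda>j. T s (w j)) k (\<lambda>i. T s (b i)) M"
    if "s \<in> carrier G" "has_coords (int_scale scale) m w k b M" "\<And>i. i < k \<Longrightarrow> b i \<in> V"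
    for s m w k b M
    by (rule int.has_coords_image[where T = "T s", OF that(2) real_subspace_int[OF subspace_real[OF sV]] that(3)])
      (simp_all add: int_scale_def T_add T_scale that(1))

  \<comment> \<open>The intertwining relation and uniqueness\<close>
  have Tu_P: "has_coords (int_scale scale) (2 * h) (\<lambda>j. T s (u j)) (2 * g) (\<lambda>i. T s (beta i)) P"
    if s: "s \<in> carrier G" for s
    by (rule T_image[OF s P]) (rule beta_in)
  have rho_r_P: "has_coords (int_scale scale) (2 * h) (\<lambda>j. T s (u j)) (2 * g) beta (rho_r s * P)"
    if s: "s \<in> carrier G" for s
    by (rule int.has_coords_trans[OF Tu_P[OF s] rho_r[OF s]])
  \<comment> \<open>On the left \<open>u\<close> is first expanded in \<open>beta\<close> and then
    moved by \<open>T s\<close>; on the right \<open>T s (u j)\<close> is expanded in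
    \<open>u\<close> and then in \<open>beta\<close>.\<close>
  have equivariant: "rho_r s * P = P * rho_rB s" if s: "s \<in> carrier G" for s
    by (rule int.has_coords_unique[OF beta rho_r_P[OF s] int.has_coords_trans[OF rho_rB[OF s] P]])
  have unique: "N = rho_rB s"
    if s: "s \<in> carrier G" and N: "N \<in> carrier (Sp h n)" "rho_r s * P = P * N" for s N
  proof (rule int.has_coords_unique[OF u _ rho_rB[OF s]])
    \<comment> \<open>The family with coordinate matrix \<open>N\<close> in \<open>u\<close>. Its
      coordinates in \<open>beta\<close> are \<open>P * N\<close>, the same as those of
      \<open>T s (u j)\<close>, so the two families agree; this replaces an argument by the column
      rank of \<open>P\<close>.\<close>
    define w where "w j = (\<Sum>i<2 * h. int_scale scale (N $$ (i, j)) (u i))" for j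
    have w: "has_coords (int_scale scale) (2 * h) w (2 * h) u N"
      using N(1) by (simp add: has_coords_def w_def Sp_def)
    then have "has_coords (int_scale scale) (2 * h) w (2 * g) beta (rho_r s * P)"
      using int.has_coords_trans[OF w P] N(2) by simp
    with rho_r_P[OF s] have "T s (u j) = w j" if "j < 2 * h" for j
      using that by (simp add: has_coords_def)
    then show "has_coords (int_scale scale) (2 * h) (\<lambda>j. T s (u j)) (2 * h) u N"
      using has_coords_cong[OF w] by simp
  qed

  \<comment> \<open>The restricted representation is symplectic\<close>
  have Sp: "rho_rB s \<in> carrier (Sp h n)" if s: "s \<in> carrier G" for s
  proof -
    have N: "rho_rB s \<in> carrier_mat (2 * h) (2 * h)"
      using rho_rB[OF s] by (simp add: has_coords_def)
    \<comment> \<open>\<open>T s\<close> preserves the pairings of \<open>beta\<close> because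
      \<open>rho_r s\<close> is symplectic. As \<open>P\<close> expands both \<open>u\<close> in
      \<open>beta\<close> and the images of \<open>u\<close> in those of \<open>beta\<close>, the
      pairings of \<open>u\<close> are preserved as well.\<close>
    have gram_T: "F (T s (beta i)) (T s (beta j)) = of_int (J_mat g d $$ (i, j))"
      if "i < 2 * g" "j < 2 * g" for i j
    proof -
      have "(rho_r s)\<^sup>T * J_mat g d * rho_r s = J_mat g d"
        using assms(8) s by (simp add: Sp_def)
      then show ?thesis
        using A.gram_congruence[OF rho_r[OF s] J_mat_carrier gram_beta _ _ that] beta_in T_V s by simp
    qed
    have "(rho_rB s)\<^sup>T * J_mat h n * rho_rB s = J_mat h n"
    proof (rule eq_matI)
      fix i j
      assume "i < dim_row (J_mat h n)" "j < dim_col (J_mat h n)"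
      then have ij: "i < 2 * h" "j < 2 * h"
        using J_mat_carrier[of h n] by auto
      have "real_of_int (((rho_rB s)\<^sup>T * J_mat h n * rho_rB s) $$ (i, j)) = F (T s (u i)) (T s (u j))"
        using A.gram_congruence[OF rho_rB[OF s] J_mat_carrier gram_u _ _ ij] u_in T_V s by simp
      also have "\<dots> = of_int ((P\<^sup>T * J_mat g d * P) $$ (i, j))"
        using A.gram_congruence[OF Tu_P[OF s] J_mat_carrier gram_T _ _ ij] beta_in u_in T_V s by simp
      also have "\<dots> = F (u i) (u j)"
        using A.gram_congruence[OF P J_mat_carrier gram_beta _ _ ij] beta_in u_in by simp
      also have "\<dots> = of_int (J_mat h n $$ (i, j))"
        by (rule gram_u[OF ij])
      finally show "((rho_rB s)\<^sup>T * J_mat h n * rho_rB s) $$ (i, j) = J_mat h n $$ (i, j)"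
        by simp
    qed (use N J_mat_carrier[of h n] in auto)
    then show ?thesis
      using N by (simp add: Sp_def)
  qed

  \<comment> \<open>Multiplicativity\<close>
  interpret action: group_action G "torus V L" act
    using assms(5) by (simp add: action_by_automorphisms_def)
  interpret G: group G
    using action.group_hom by (simp add: group_hom_def)
  have mult: "rho_rB (s \<otimes>\<^bsub>G\<^esub> t) = rho_rB s * rho_rB t"
    if s: "s \<in> carrier G" and t: "t \<in> carrier G" for s t
  proof (rule int.has_coords_unique[OF u rho_rB])
    show st: "s \<otimes>\<^bsub>G\<^esub> t \<in> carrier G"
      using s t by simp
    \<comment> \<open>The composition law of the action concerns points of the torus; uniqueness of
      lifts carries it over to \<open>V\<close>.\<close>
    have "induces scale V L V L (compose V (T s) (T t)) (act (s \<otimes>\<^bsub>G\<^esub> t))"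
      using s t action.composition_rule by (intro induces_compose[OF A T T]) auto
    then have "T (s \<otimes>\<^bsub>G\<^esub> t) = compose V (T s) (T t)"
      unfolding T_def[of "s \<otimes>\<^bsub>G\<^esub> t"] by (rule induced_linear_map_eqI[OF A A])
    then have eq: "T s (T t (u j)) = T (s \<otimes>\<^bsub>G\<^esub> t) (u j)" if "j < 2 * h" for j
      using u_in[OF that] by (simp add: compose_def)
    have "has_coords (int_scale scale) (2 * h) (\<lambda>j. T s (T t (u j))) (2 * h) u (rho_rB s * rho_rB t)"
      using u_in by (intro int.has_coords_trans[OF T_image[OF s rho_rB[OF t]] rho_rB[OF s]]) auto
    then show "has_coords (int_scale scale) (2 * h) (\<lambda>j. T (s \<otimes>\<^bsub>G\<^esub> t) (u j)) (2 * h) u (rho_rB s * rho_rB t)"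
      by (rule has_coords_cong) (use eq in auto)
  qed
  have hom: "rho_rB \<in> hom G (Sp h n)"
    using Sp mult by (auto simp: hom_def Sp_def)

  \<comment> \<open>The period matrix\<close>
  define Z where "Z = coord_mat scale h (\<lambda>j. u (h + j)) h alphaB"
  have Z: "has_coords scale h (\<lambda>j. u (h + j)) h alphaB Z"
    unfolding Z_def by (rule has_coords_coord_mat[OF basis]) (simp add: u_in)
  then have Zc: "Z \<in> carrier_mat h h"
    by (simp add: has_coords_def)
  have Dc: "D \<in> carrier_mat h h"
    by (simp add: assms(18) complex_mat_def)
  have DZ: "has_coords scale (2 * h) u h alphaB (beside D Z)"
    unfolding assms(18) alphaB by (rule B.has_coords_beside) (use Z in \<open>simp add: alphaB\<close>)
  then have PiB: "PiB = beside D Z"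
    unfolding assms(17) period_matrix_def by (rule coord_mat_eqI[OF basis])

  \<comment> \<open>The quadratic equation and the analytic representation\<close>
  have rel: "rho_aB s * beside D Z = beside D Z * complex_mat (rho_rB s)" if s: "s \<in> carrier G" for s
  proof (rule has_coords_unique[OF basis])
    \<comment> \<open>Again \<open>T s (u j)\<close> is expanded in two ways, now in
      \<open>alphaB\<close>: through the images \<open>T s (alphaB i)\<close>, and through
      \<open>u\<close> with the integral matrix read as a complex one.\<close>
    have "has_coords scale (2 * h) (\<lambda>j. T s (u j)) h (\<lambda>i. T s (alphaB i)) (beside D Z)"
    proof (rule has_coords_image[where T = "T s", OF DZ sVB])
      show "alphaB i \<in> VB" if "i < h" for i
        using that by (simp add: alphaB B.a_in)
    qed (use s B(2) T_add T_scale in \<open>auto simp: subset_iff\<close>)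
    then show "has_coords scale (2 * h) (\<lambda>j. T s (u j)) h alphaB (rho_aB s * beside D Z)"
      by (rule has_coords_trans) (rule rho_aB[OF s])
    show "has_coords scale (2 * h) (\<lambda>j. T s (u j)) h alphaB (beside D Z * complex_mat (rho_rB s))"
      by (rule has_coords_trans[OF has_coords_complex_mat[OF rho_rB[OF s]] DZ])
  qed
  have D_inv: "mat_inv D \<in> carrier_mat h h" "D * mat_inv D = 1\<^sub>m h"
    unfolding assms(18) using n_pos by (auto intro!: mat_inv_diag simp: less_le)
  have blocks: "\<exists>\<alpha> \<mu> \<gamma> \<delta>. {\<alpha>, \<mu>, \<gamma>, \<delta>} \<subseteq> carrier_mat h h \<and>
      rho_rB s = four_block_mat \<alpha> \<mu> \<gamma> \<delta> \<and>
      Z * complex_mat \<gamma> * mat_inv D * Z + D * complex_mat \<alpha> * mat_inv D * Z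
        - Z * complex_mat \<delta> - D * complex_mat \<mu> = 0\<^sub>m h h \<and>
      rho_aB s = (D * complex_mat \<alpha> + Z * complex_mat \<gamma>) * mat_inv D"
    if s: "s \<in> carrier G" for s
  proof -
    obtain \<alpha> \<mu> \<gamma> \<delta> where split: "split_block (rho_rB s) h h = (\<alpha>, \<mu>, \<gamma>, \<delta>)"
      by (metis prod_cases4)
    have "dim_row (rho_rB s) = h + h" "dim_col (rho_rB s) = h + h"
      using rho_rB[OF s] by (auto simp: has_coords_def)
    note b = split_block[OF split this]
    have "rho_aB s \<in> carrier_mat h h"
      using rho_aB[OF s] by (simp add: has_coords_def)
    from period_relation[OF Dc Zc this D_inv b(1-4)] rel[OF s] b
    show ?thesis
      by (intro exI[of _ \<alpha>] exI[of _ \<mu>] exI[of _ \<gamma>] exI[of _ \<delta>]) simp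
  qed
  have Siegel: "Z \<in> Siegel_space h"
    by (rule B.period_in_Siegel_space) (use Z in \<open>simp add: alphaB\<close>)
  show ?thesis
    by (intro conjI ballI impI bexI[OF _ Siegel] hom equivariant basis PiB blocks) (use unique in auto)
qed

end
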